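(* Let $R$ be a ring. (1) Every Euclidean $R$-module is a Noetherian module. (2) Each nonzero submodule $N$ of an l-finite Euclidean $R$-module $(M,d)$ is co-finite (i.e. $M/N$ has finite length), with $l_R(M/N)\le l([g(M),g(N)])$. Furthermore, if the poset in which $d$ takes values is $(\mathbb{N},\ge)$ then $l_R(M/N)\le g(N)+1$.
   Context: Rings are unital and modules are left modules; $l_R$ denotes length of an $R$-module. A poset is Artinian if every descending chain in it stabilizes. For elements $i\le j$ of a poset, $[i,j]:=\{k: i\le k\le j\}$, and its length is $l([i,j]):=\sup\{k\in\mathbb{N}: \text{there is a chain } i=i_1<i_2<\cdots<i_k=j\}$. An $R$-module $M$ is a Euclidean module if there is a function $d:M\setminus\{0\}\to P$ to a poset $(P,\ge)$ such that the poset $\mathrm{im}(d)$ is Artinian and, for any nonzero $u,v\in M$, there are $q\in R$ and $r\in M$ with $u=qv+r$ and either $r=0$ or $d(r)<d(v)$. In part (2), for a nonzero submodule $N\subseteq M$, $g(N):=\min\{d(x):0\neq x\in N\}$ (the least value; it is presupposed to exist). $(M,d)$ is l-finite if every interval in the poset $\mathrm{im}(d)$ has finite length (equivalently $l([g(M),d(m)])<\infty$ for all nonzero $m\in M$); the interval $[g(M),g(N)]$ is taken in $\mathrm{im}(d)$. *)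

theory Defs
  imports "HOL-Algebra.Module" "HOL-Algebra.QuotRing" "HOL-Library.Extended_Nat"
begin

section \<open>Left modules over an arbitrary unital ring\<close>

text \<open>
  The locale \<^locale>\<open>module\<close> assumes a commutative ring of scalars. The following is its
  verbatim analogue for a possibly non-commutative ring; the record type of modules and the
  locale \<^locale>\<open>submodule\<close> do not depend on commutativity and are reused.
\<close>

locale left_module = R?: ring R + M?: abelian_group M
  for R :: "('a, 'r) ring_scheme" (structure) and M :: "('a, 'b, 'm) module_scheme" (structure) +
  assumes smult_closed [simp, intro]:
      "\<lbrakk>a \<in> carrier R; x \<in> carrier M\<rbrakk> \<Longrightarrow> a \<odot>\<^bsub>M\<^esub> x \<in> carrier M"
    and smult_l_distr:
      "\<lbrakk>a \<in> carrier R; b \<in> carrier R; x \<in> carrier M\<rbrakk> \<Longrightarrow>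
      (a \<oplus>\<^bsub>R\<^esub> b) \<odot>\<^bsub>M\<^esub> x = a \<odot>\<^bsub>M\<^esub> x \<oplus>\<^bsub>M\<^esub> b \<odot>\<^bsub>M\<^esub> x"
    and smult_r_distr:
      "\<lbrakk>a \<in> carrier R; x \<in> carrier M; y \<in> carrier M\<rbrakk> \<Longrightarrow>
      a \<odot>\<^bsub>M\<^esub> (x \<oplus>\<^bsub>M\<^esub> y) = a \<odot>\<^bsub>M\<^esub> x \<oplus>\<^bsub>M\<^esub> a \<odot>\<^bsub>M\<^esub> y"
    and smult_assoc1:
      "\<lbrakk>a \<in> carrier R; b \<in> carrier R; x \<in> carrier M\<rbrakk> \<Longrightarrow>
      (a \<otimes>\<^bsub>R\<^esub> b) \<odot>\<^bsub>M\<^esub> x = a \<odot>\<^bsub>M\<^esub> (b \<odot>\<^bsub>M\<^esub> x)"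
    and smult_one [simp]:
      "x \<in> carrier M \<Longrightarrow> \<one>\<^bsub>R\<^esub> \<odot>\<^bsub>M\<^esub> x = x"

definition noetherian_module :: "('a, 'r) ring_scheme \<Rightarrow> ('a, 'b, 'm) module_scheme \<Rightarrow> bool"
  where "noetherian_module R M \<longleftrightarrow> left_module R M \<and>
    (\<forall>S :: nat \<Rightarrow> 'b set. (\<forall>n. submodule (S n) R M) \<and> (\<forall>n. S n \<subseteq> S (Suc n)) \<longrightarrow>
      (\<exists>n. \<forall>m\<ge>n. S m = S n))"

text \<open>
  The multiplicative fields of a module record are never used for modules, hence the
  \<^const>\<open>undefined\<close> entries. The scalar multiplication on cosets is
  \<open>a \<odot> (N + x) = N + a \<odot> x\<close>, written without choosing representatives in the style of
  \<^const>\<open>rcoset_mult\<close>.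
\<close>

definition quotient_module :: "('a, 'b, 'm) module_scheme \<Rightarrow> 'b set \<Rightarrow> ('a, 'b set) module"
  where "quotient_module M N =
    \<lparr>carrier = a_rcosets\<^bsub>M\<^esub> N, mult = undefined, one = undefined, zero = N,
      add = set_add M, smult = (\<lambda>a C. \<Union>x\<in>C. N +>\<^bsub>M\<^esub> (a \<odot>\<^bsub>M\<^esub> x))\<rparr>"

text \<open>The length of a module counts the strict inclusions in a chain of submodules.\<close>

definition module_length :: "('a, 'r) ring_scheme \<Rightarrow> ('a, 'b, 'm) module_scheme \<Rightarrow> enat"
  where "module_length R M =
    Sup {enat n | n. \<exists>S :: nat \<Rightarrow> 'b set.
      (\<forall>i\<le>n. submodule (S i) R M) \<and> (\<forall>i<n. S i \<subset> S (Suc i))}"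

definition cofinite_submodule ::
    "('a, 'r) ring_scheme \<Rightarrow> ('a, 'b, 'm) module_scheme \<Rightarrow> 'b set \<Rightarrow> bool"
  where "cofinite_submodule R M N \<longleftrightarrow> module_length R (quotient_module M N) < \<infinity>"


section \<open>Subposets of an ordered type\<close>

definition artinian_poset :: "'p::order set \<Rightarrow> bool"
  where "artinian_poset P \<longleftrightarrow>
    (\<forall>f :: nat \<Rightarrow> 'p. (\<forall>n. f n \<in> P) \<and> (\<forall>n. f (Suc n) \<le> f n) \<longrightarrow> (\<exists>n. \<forall>m\<ge>n. f m = f n))"

text \<open>
  The length of the interval \<open>[i, j]\<close> of the subposet \<open>P\<close>. In contrast to
  \<^const>\<open>module_length\<close> it counts the elements \<open>i = c 1 < \<dots> < c k = j\<close> of a chain.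
\<close>

definition interval_length :: "'p::order set \<Rightarrow> 'p \<Rightarrow> 'p \<Rightarrow> enat"
  where "interval_length P i j =
    Sup {enat k | k. k \<ge> 1 \<and> (\<exists>c :: nat \<Rightarrow> 'p. c 1 = i \<and> c k = j \<and>
      (\<forall>n\<in>{1..k}. c n \<in> P) \<and> (\<forall>n\<in>{1..<k}. c n < c (Suc n)))}"


section \<open>Euclidean modules\<close>

definition nonzero_image ::
    "('a, 'b, 'm) module_scheme \<Rightarrow> ('b \<Rightarrow> 'p) \<Rightarrow> 'b set \<Rightarrow> 'p set"
  where "nonzero_image M d N = d ` (N - {\<zero>\<^bsub>M\<^esub>})"

text \<open>
  The values of \<open>d\<close> outside \<open>carrier M - {\<zero>}\<close> are irrelevant; \<open>im(d)\<close> is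
  \<open>nonzero_image M d (carrier M)\<close>.
\<close>

locale euclidean_module = left_module R M
  for R :: "('a, 'r) ring_scheme" (structure) and M :: "('a, 'b, 'm) module_scheme" (structure) +
  fixes d :: "'b \<Rightarrow> 'p::order"
  assumes artinian: "artinian_poset (nonzero_image M d (carrier M))"
    and division: "\<lbrakk>u \<in> carrier M - {\<zero>\<^bsub>M\<^esub>}; v \<in> carrier M - {\<zero>\<^bsub>M\<^esub>}\<rbrakk> \<Longrightarrow>
      \<exists>q\<in>carrier R. \<exists>r\<in>carrier M.
        u = q \<odot>\<^bsub>M\<^esub> v \<oplus>\<^bsub>M\<^esub> r \<and> (r = \<zero>\<^bsub>M\<^esub> \<or> d r < d v)"

definition l_finite :: "('a, 'b, 'm) module_scheme \<Rightarrow> ('b \<Rightarrow> 'p::order) \<Rightarrow> bool"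
  where "l_finite M d \<longleftrightarrow>
    (\<forall>i \<in> nonzero_image M d (carrier M). \<forall>j \<in> nonzero_image M d (carrier M).
      i \<le> j \<longrightarrow> interval_length (nonzero_image M d (carrier M)) i j < \<infinity>)"

text \<open>
  The minimum \<open>g(N)\<close> is a least value, which need not exist in a poset;
  \<open>least_value M d N\<close> is meaningful only if \<open>has_least_value M d N\<close> holds.
\<close>

definition has_least_value ::
    "('a, 'b, 'm) module_scheme \<Rightarrow> ('b \<Rightarrow> 'p::order) \<Rightarrow> 'b set \<Rightarrow> bool"
  where "has_least_value M d N \<longleftrightarrow>
    (\<exists>p \<in> nonzero_image M d N. \<forall>q \<in> nonzero_image M d N. p \<le> q)"

definition least_value :: "('a, 'b, 'm) module_scheme \<Rightarrow> ('b \<Rightarrow> 'p::order) \<Rightarrow> 'b set \<Rightarrow> 'p"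
  where "least_value M d N = (LEAST p. p \<in> nonzero_image M d N)"

end

theory Submission
  imports Defs
begin

text \<open>
  If \<open>A \<subset> B\<close> are submodules and \<open>0 \<noteq> v \<in> A\<close>, then dividing an element of \<open>B - A\<close> by \<open>v\<close> leaves
  a remainder in \<open>B - A\<close>, whose \<open>d\<close>-value is smaller than \<open>d v\<close>. Hence an element of minimal
  \<open>d\<close>-value in the union of an ascending chain of submodules makes the chain stop, and a chain
  \<open>N \<subseteq> T 0 \<subset> \<dots> \<subset> T n\<close> of submodules gives a chain of \<open>n + 1\<close> values descending from any value
  of \<open>d\<close> on \<open>N\<close>. Chains in \<open>M/N\<close> are pulled back to \<open>M\<close>.
\<close>

section \<open>Minimal elements in Artinian posets\<close>

lemma artinian_posetE_min:
  assumes "artinian_poset P" "A \<subseteq> P" "A \<noteq> {}"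
  obtains p where "p \<in> A" "\<And>q. q \<in> A \<Longrightarrow> \<not> q < p"
proof (rule ccontr)
  assume "\<not> thesis"
  then have "\<forall>p. p \<in> A \<longrightarrow> (\<exists>q. q \<in> A \<and> q < p)"
    using that by blast
  then obtain s where s: "\<And>p. p \<in> A \<Longrightarrow> s p \<in> A \<and> s p < p"
    by metis
  obtain a where a: "a \<in> A"
    using assms(3) by blast
  \<comment> \<open>If no element of \<open>A\<close> is minimal, iterating the choice
    \<open>s\<close> of a smaller element gives a strictly descending sequence, which cannot
    stabilize.\<close>
  define f where "f n = (s ^^ n) a" for n
  have fA: "f n \<in> A" for n
    by (induction n) (auto simp: f_def a s)
  have less: "f (Suc n) < f n" for n
    using s[OF fA[of n]] by (simp add: f_def)
  have "\<exists>n. \<forall>m\<ge>n. f m = f n"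
    using assms(1,2) fA less unfolding artinian_poset_def by (meson less_imp_le subsetD)
  then obtain n where "f (Suc n) = f n"
    using le_SucI by blast
  then show False
    using less[of n] by simp
qed

section \<open>Submodules and quotients of left modules\<close>

context left_module
begin

lemma smult_l_null: "x \<in> carrier M \<Longrightarrow> \<zero> \<odot>\<^bsub>M\<^esub> x = \<zero>\<^bsub>M\<^esub>"
  using smult_l_distr[of "\<zero>" "\<zero>" x] by (simp add: M.add.r_cancel_one')

lemma smult_minus_one:
  assumes "x \<in> carrier M"
  shows "(\<ominus> \<one>) \<odot>\<^bsub>M\<^esub> x = \<ominus>\<^bsub>M\<^esub> x"
proof (rule M.minus_equality[symmetric])
  show "(\<ominus> \<one>) \<odot>\<^bsub>M\<^esub> x \<oplus>\<^bsub>M\<^esub> x = \<zero>\<^bsub>M\<^esub>"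
    using smult_l_distr[of "\<ominus> \<one>" "\<one>" x] assms by (simp add: R.l_neg smult_l_null)
qed (use assms in auto)

text \<open>Closure under negation comes from multiplying by the scalar
  \<open>\<ominus> \<one>\<close>.\<close>

lemma submoduleI':
  assumes "H \<subseteq> carrier M" "\<zero>\<^bsub>M\<^esub> \<in> H"
    and add: "\<And>x y. \<lbrakk>x \<in> H; y \<in> H\<rbrakk> \<Longrightarrow> x \<oplus>\<^bsub>M\<^esub> y \<in> H"
    and smult: "\<And>a x. \<lbrakk>a \<in> carrier R; x \<in> H\<rbrakk> \<Longrightarrow> a \<odot>\<^bsub>M\<^esub> x \<in> H"
  shows "submodule H R M"
proof (rule submodule.intro)
  show "subgroup H (add_monoid M)"
  proof (rule subgroup.intro)
    fix x assume "x \<in> H"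
    then have "\<ominus>\<^bsub>M\<^esub> x \<in> H"
      using smult[of "\<ominus> \<one>" x] assms(1) smult_minus_one[of x] by auto
    then show "inv\<^bsub>add_monoid M\<^esub> x \<in> H"
      by (simp add: a_inv_def)
  qed (use assms in auto)
  show "submodule_axioms H R M"
    using smult by (simp add: submodule_axioms_def)
qed

lemma submodule_abelian_subgroup:
  assumes "submodule N R M"
  shows "abelian_subgroup N M"
proof (rule abelian_subgroupI3[OF additive_subgroup.intro])
  show "subgroup N (add_monoid M)"
    using assms by (simp add: submodule_def)
qed (rule M.abelian_group_axioms)

lemma submodule_minus:
  assumes "submodule N R M" "x \<in> N" "y \<in> N"
  shows "x \<ominus>\<^bsub>M\<^esub> y \<in> N"
proof -
  interpret N: abelian_subgroup N M
    by (rule submodule_abelian_subgroup[OF assms(1)])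
  show ?thesis
    using assms(2,3) by (simp add: M.minus_eq)
qed

text \<open>The union over all representatives in \<open>quotient_module\<close> collapses to one
  coset: replacing \<open>x\<close> by \<open>n + x\<close> with \<open>n\<close> in
  \<open>N\<close> changes the product by \<open>a n\<close>, which lies in \<open>N\<close>
  again.\<close>

lemma quotient_smult:
  assumes N: "submodule N R M" and a: "a \<in> carrier R" and x: "x \<in> carrier M"
  shows "a \<odot>\<^bsub>quotient_module M N\<^esub> (N +>\<^bsub>M\<^esub> x) = N +>\<^bsub>M\<^esub> (a \<odot>\<^bsub>M\<^esub> x)"
proof -
  interpret N: abelian_subgroup N M
    by (rule submodule_abelian_subgroup[OF N])
  have const: "N +>\<^bsub>M\<^esub> (a \<odot>\<^bsub>M\<^esub> y) = N +>\<^bsub>M\<^esub> (a \<odot>\<^bsub>M\<^esub> x)" if y: "y \<in> N +>\<^bsub>M\<^esub> x" for y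
  proof -
    obtain n where n: "n \<in> N" "y = n \<oplus>\<^bsub>M\<^esub> x"
      using y by (auto simp: a_r_coset_def' )
    then have "a \<odot>\<^bsub>M\<^esub> y = a \<odot>\<^bsub>M\<^esub> n \<oplus>\<^bsub>M\<^esub> a \<odot>\<^bsub>M\<^esub> x"
      using a x N.a_Hcarr by (simp add: smult_r_distr)
    moreover have "a \<odot>\<^bsub>M\<^esub> n \<in> N"
      using N a n(1) by (simp add: submodule.smult_closed)
    ultimately have "a \<odot>\<^bsub>M\<^esub> y \<in> N +>\<^bsub>M\<^esub> (a \<odot>\<^bsub>M\<^esub> x)"
      by (auto simp: a_r_coset_def')
    then show ?thesis
      using N.a_repr_independence'[of "a \<odot>\<^bsub>M\<^esub> y" "a \<odot>\<^bsub>M\<^esub> x"] a x by simp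
  qed
  have "(\<Union>y\<in>N +>\<^bsub>M\<^esub> x. N +>\<^bsub>M\<^esub> (a \<odot>\<^bsub>M\<^esub> y)) = N +>\<^bsub>M\<^esub> (a \<odot>\<^bsub>M\<^esub> x)"
    using const by (intro UN_constant_eq[OF N.a_rcos_self[OF x]] ballI)
  then show ?thesis
    by (simp add: quotient_module_def)
qed

text \<open>This is the preimage of \<open>S\<close> under the projection sending \<open>x\<close>
  to its coset. The projection respects sums and scalars, so the closure properties of
  \<open>S\<close> pass directly to the preimage.\<close>

lemma submodule_quotient_vimage:
  assumes N: "submodule N R M" and S: "submodule S R (quotient_module M N)"
  shows "submodule {x \<in> carrier M. N +>\<^bsub>M\<^esub> x \<in> S} R M"
proof -
  interpret N: abelian_subgroup N M
    by (rule submodule_abelian_subgroup[OF N])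
  have S_subgroup: "subgroup S (add_monoid (quotient_module M N))"
    using S by (simp add: submodule_def)
  show ?thesis
  proof (rule submoduleI')
    have "N +>\<^bsub>M\<^esub> \<zero>\<^bsub>M\<^esub> = N"
      using M.a_coset_add_zero N.a_subset by blast
    then show "\<zero>\<^bsub>M\<^esub> \<in> {x \<in> carrier M. N +>\<^bsub>M\<^esub> x \<in> S}"
      using subgroup.one_closed[OF S_subgroup] by (simp add: quotient_module_def)
  next
    fix x y
    assume "x \<in> {x \<in> carrier M. N +>\<^bsub>M\<^esub> x \<in> S}" "y \<in> {x \<in> carrier M. N +>\<^bsub>M\<^esub> x \<in> S}"
    then show "x \<oplus>\<^bsub>M\<^esub> y \<in> {x \<in> carrier M. N +>\<^bsub>M\<^esub> x \<in> S}"
      using subgroup.m_closed[OF S_subgroup, of "N +>\<^bsub>M\<^esub> x" "N +>\<^bsub>M\<^esub> y"]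
      by (simp add: quotient_module_def N.a_rcos_sum)
  next
    fix a x
    assume "a \<in> carrier R" "x \<in> {x \<in> carrier M. N +>\<^bsub>M\<^esub> x \<in> S}"
    then show "a \<odot>\<^bsub>M\<^esub> x \<in> {x \<in> carrier M. N +>\<^bsub>M\<^esub> x \<in> S}"
      using submodule.smult_closed[OF S, of a "N +>\<^bsub>M\<^esub> x"] by (simp add: quotient_smult[OF N])
  qed auto
qed

lemma quotient_chain_lift:
  assumes N: "submodule N R M"
    and S: "\<And>i. i \<le> n \<Longrightarrow> submodule (S i) R (quotient_module M N)"
    and strict: "\<And>i. i < n \<Longrightarrow> S i \<subset> S (Suc i)"
  obtains T where "\<And>i. i \<le> n \<Longrightarrow> submodule (T i) R M" "\<And>i. i < n \<Longrightarrow> T i \<subset> T (Suc i)" "N \<subseteq> T 0"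
proof
  interpret N: abelian_subgroup N M
    by (rule submodule_abelian_subgroup[OF N])
  have S_subgroup: "subgroup (S i) (add_monoid (quotient_module M N))" if "i \<le> n" for i
    using S[OF that] by (simp add: submodule_def)
  let ?T = "\<lambda>i. {x \<in> carrier M. N +>\<^bsub>M\<^esub> x \<in> S i}"
  show "submodule (?T i) R M" if "i \<le> n" for i
    using N S[OF that] by (rule submodule_quotient_vimage)
  show "?T i \<subset> ?T (Suc i)" if i: "i < n" for i
  proof -
    \<comment> \<open>Surjectivity of the projection keeps the inclusion strict: a representative of
      \<open>C\<close> separates the two preimages.\<close>
    obtain C where C: "C \<in> S (Suc i)" "C \<notin> S i"
      using strict[OF i] by blast
    then have "C \<in> a_rcosets\<^bsub>M\<^esub> N"
      using subgroup.subset[OF S_subgroup[of "Suc i"]] i by (auto simp: quotient_module_def)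
    then obtain x where "x \<in> carrier M" "C = N +>\<^bsub>M\<^esub> x"
      by (auto simp: A_RCOSETS_def')
    then show ?thesis
      using C strict[OF i] by blast
  qed
  show "N \<subseteq> ?T 0"
  proof
    fix x assume x: "x \<in> N"
    then have "N +>\<^bsub>M\<^esub> x = N"
      by (simp add: N.a_rcos_const)
    then show "x \<in> ?T 0"
      using x subgroup.one_closed[OF S_subgroup[of 0]] by (simp add: quotient_module_def)
  qed
qed

end

section \<open>Division and chains of submodules in Euclidean modules\<close>

context euclidean_module
begin

text \<open>For \<open>u\<close> in \<open>B - A\<close> write \<open>u = q v + r\<close>. Since
  \<open>q v\<close> lies in \<open>A\<close>, a remainder in \<open>A\<close> would force
  \<open>u\<close> into \<open>A\<close>; in particular \<open>r\<close> is nonzero, so division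
  gives \<open>d r < d v\<close>. As \<open>r = u - q v\<close>, it stays in
  \<open>B\<close>.\<close>

lemma remainder_outside:
  assumes A: "submodule A R M" and B: "submodule B R M" and less: "A \<subset> B"
    and v: "v \<in> A" "v \<noteq> \<zero>\<^bsub>M\<^esub>"
  obtains r where "r \<in> B" "r \<notin> A" "r \<noteq> \<zero>\<^bsub>M\<^esub>" "d r < d v"
proof -
  interpret A: abelian_subgroup A M
    by (rule submodule_abelian_subgroup[OF A])
  interpret B: abelian_subgroup B M
    by (rule submodule_abelian_subgroup[OF B])
  obtain u where u: "u \<in> B" "u \<notin> A"
    using less by blast
  then have "u \<noteq> \<zero>\<^bsub>M\<^esub>"
    using A.zero_closed by blast
  then obtain q r where qr: "q \<in> carrier R" "r \<in> carrier M" "u = q \<odot>\<^bsub>M\<^esub> v \<oplus>\<^bsub>M\<^esub> r"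
      "r = \<zero>\<^bsub>M\<^esub> \<or> d r < d v"
    using division[of u v] u v by auto
  have qv: "q \<odot>\<^bsub>M\<^esub> v \<in> A"
    using A qr(1) v(1) by (simp add: submodule.smult_closed)
  have "r \<notin> A"
    using qv qr(3) u(2) A.a_closed by blast
  then have "r \<noteq> \<zero>\<^bsub>M\<^esub>"
    using A.zero_closed by blast
  have "r = u \<ominus>\<^bsub>M\<^esub> q \<odot>\<^bsub>M\<^esub> v"
    using qr(2,3) A.a_Hcarr[OF qv] by (simp add: M.minus_eq M.a_ac M.r_neg M.r_neg1)
  also have "\<dots> \<in> B"
    using submodule_minus[OF B u(1)] qv less by blast
  finally show ?thesis
    using that \<open>r \<notin> A\<close> \<open>r \<noteq> \<zero>\<^bsub>M\<^esub>\<close> qr(4) by blast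
qed

lemma noetherian: "noetherian_module R M"
  unfolding noetherian_module_def
proof (intro conjI allI impI left_module_axioms)
  fix S :: "nat \<Rightarrow> 'b set"
  assume "(\<forall>n. submodule (S n) R M) \<and> (\<forall>n. S n \<subseteq> S (Suc n))"
  then have S: "submodule (S n) R M" and step: "S n \<subseteq> S (Suc n)" for n
    by auto
  have mono: "S i \<subseteq> S j" if "i \<le> j" for i j
    using step that by (rule lift_Suc_mono_le)
  have carr: "S n \<subseteq> carrier M" and zero: "\<zero>\<^bsub>M\<^esub> \<in> S n" for n
    using S[of n] subgroup.subset subgroup.one_closed by (force simp: submodule_def)+
  show "\<exists>n. \<forall>m\<ge>n. S m = S n"
  proof (cases "nonzero_image M d (\<Union>n. S n) = {}")
    \<comment> \<open>All \<open>S n\<close> are zero here. The case is separate because a minimal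
      value can be chosen only from a nonempty set.\<close>
    case True
    then have "S n = {\<zero>\<^bsub>M\<^esub>}" for n
      using zero[of n] by (auto simp: nonzero_image_def)
    then show ?thesis
      by simp
  next
    case False
    have "nonzero_image M d (\<Union>n. S n) \<subseteq> nonzero_image M d (carrier M)"
      using carr by (force simp: nonzero_image_def)
    \<comment> \<open>Minimality is taken over the union of the whole chain, so that it also
      excludes smaller values on every later \<open>S m\<close>.\<close>
    from artinian_posetE_min[OF artinian this False]
    obtain p where p: "p \<in> nonzero_image M d (\<Union>n. S n)"
      and min: "\<And>q. q \<in> nonzero_image M d (\<Union>n. S n) \<Longrightarrow> \<not> q < p"
      by blast
    then obtain v n where v: "v \<in> S n" "v \<noteq> \<zero>\<^bsub>M\<^esub>" "p = d v"
      by (auto simp: nonzero_image_def)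
    have "S m = S n" if "n \<le> m" for m
    proof (rule ccontr)
      assume "S m \<noteq> S n"
      then have "S n \<subset> S m"
        using mono[OF that] by blast
      from remainder_outside[OF S S this v(1,2)]
      obtain r where "r \<in> S m" "r \<noteq> \<zero>\<^bsub>M\<^esub>" "d r < d v"
        by blast
      then show False
        using min[of "d r"] v(3) by (auto simp: nonzero_image_def)
    qed
    then show ?thesis
      by blast
  qed
qed

text \<open>Iterates \<open>remainder_outside\<close>: the remainder found in
  \<open>T (Suc i)\<close> becomes the divisor for the next step. The start \<open>x\<close> is left
  free so that it can be chosen in \<open>N\<close> with a prescribed value of
  \<open>d\<close>.\<close>

lemma descending_values:
  assumes "\<And>i. i \<le> n \<Longrightarrow> submodule (T i) R M" "\<And>i. i < n \<Longrightarrow> T i \<subset> T (Suc i)"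
    and "x \<in> T 0" "x \<noteq> \<zero>\<^bsub>M\<^esub>"
  shows "\<exists>v. v 0 = x \<and> (\<forall>i\<le>n. v i \<in> T i - {\<zero>\<^bsub>M\<^esub>}) \<and> (\<forall>i<n. d (v (Suc i)) < d (v i))"
  using assms(1,2)
proof (induction n)
  case 0
  then show ?case
    using assms(3,4) by auto
next
  case (Suc n)
  then obtain v where v: "v 0 = x" "\<forall>i\<le>n. v i \<in> T i - {\<zero>\<^bsub>M\<^esub>}" "\<forall>i<n. d (v (Suc i)) < d (v i)"
    by (metis le_SucI less_SucI)
  obtain r where "r \<in> T (Suc n)" "r \<noteq> \<zero>\<^bsub>M\<^esub>" "d r < d (v n)"
    using remainder_outside[of "T n" "T (Suc n)" "v n"] Suc.prems v(2)
    by (metis Diff_iff insertI1 le_SucI le_refl lessI)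
  then have "(v(Suc n := r)) 0 = x \<and> (\<forall>i\<le>Suc n. (v(Suc n := r)) i \<in> T i - {\<zero>\<^bsub>M\<^esub>}) \<and>
      (\<forall>i<Suc n. d ((v(Suc n := r)) (Suc i)) < d ((v(Suc n := r)) i))"
    using v by (auto simp: le_Suc_eq less_Suc_eq)
  then show ?case
    by blast
qed

text \<open>Reduces both length estimates to a question about the poset alone: how often can
  \<open>d\<close> drop strictly when starting from \<open>d x\<close>? Each strict inclusion in a
  chain of the quotient costs one drop.\<close>

lemma quotient_length_leI:
  assumes N: "submodule N R M" and x: "x \<in> N" "x \<noteq> \<zero>\<^bsub>M\<^esub>"
    and bound: "\<And>n v. \<lbrakk>v 0 = x; \<And>i. i \<le> n \<Longrightarrow> v i \<in> carrier M - {\<zero>\<^bsub>M\<^esub>};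
        \<And>i. i < n \<Longrightarrow> d (v (Suc i)) < d (v i)\<rbrakk> \<Longrightarrow> enat n \<le> b"
  shows "module_length R (quotient_module M N) \<le> b"
  unfolding module_length_def
proof (rule Sup_least, safe)
  fix n S
  assume "\<forall>i\<le>n. submodule (S i) R (quotient_module M N)" "\<forall>i<n. S i \<subset> S (Suc i)"
  then obtain T where T: "\<And>i. i \<le> n \<Longrightarrow> submodule (T i) R M" "\<And>i. i < n \<Longrightarrow> T i \<subset> T (Suc i)"
      "N \<subseteq> T 0"
    using quotient_chain_lift[OF N, of n S] by blast
  have "x \<in> T 0"
    using T(3) x(1) by blast
  from descending_values[OF T(1,2) this x(2)]
  obtain v where v: "v 0 = x" "\<And>i. i \<le> n \<Longrightarrow> v i \<in> T i - {\<zero>\<^bsub>M\<^esub>}"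
      "\<And>i. i < n \<Longrightarrow> d (v (Suc i)) < d (v i)"
    by blast
  have "T i \<subseteq> carrier M" if "i \<le> n" for i
    using T(1)[OF that] subgroup.subset by (force simp: submodule_def)
  then show "enat n \<le> b"
    using v by (intro bound[of v n]) blast+
qed

text \<open>The bound is stated for every nonzero \<open>x\<close> in \<open>N\<close>: finiteness
  of the length then follows even if \<open>d\<close> has no least value on \<open>N\<close>, and a
  minimizing \<open>x\<close> gives the sharp form.\<close>

lemma quotient_length_le_interval:
  assumes N: "submodule N R M" and x: "x \<in> N" "x \<noteq> \<zero>\<^bsub>M\<^esub>"
    and g: "g \<in> nonzero_image M d (carrier M)"
      "\<And>q. q \<in> nonzero_image M d (carrier M) \<Longrightarrow> g \<le> q"
  shows "module_length R (quotient_module M N)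
    \<le> interval_length (nonzero_image M d (carrier M)) g (d x)"
proof (rule quotient_length_leI[OF N x])
  fix n and v :: "nat \<Rightarrow> 'b"
  assume v: "v 0 = x" "\<And>i. i \<le> n \<Longrightarrow> v i \<in> carrier M - {\<zero>\<^bsub>M\<^esub>}"
    "\<And>i. i < n \<Longrightarrow> d (v (Suc i)) < d (v i)"
  let ?P = "nonzero_image M d (carrier M)"
  show "enat n \<le> interval_length ?P g (d x)"
  \<comment> \<open>For \<open>n = 0\<close> a chain with one element would have to satisfy both
    \<open>c 1 = g\<close> and \<open>c 1 = d x\<close>, so this case uses only that lengths are
    nonnegative.\<close>
  proof (cases "n = 0")
    case True
    then show ?thesis
      by (simp flip: zero_enat_def)
  next
    case False
    \<comment> \<open>The values are reversed, and the smallest one is replaced by \<open>g\<close>.\<close>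
    define c where "c k = (if k = 1 then g else d (v (Suc n - k)))" for k
    have "c k < c (Suc k)" if "k \<in> {1..<Suc n}" for k
    proof -
      have "d (v (Suc n - k)) < d (v (n - k))"
        using v(3)[of "n - k"] that by (simp add: Suc_diff_le)
      \<comment> \<open>This serves \<open>k = 1\<close>, where \<open>g\<close> stands in place of
        \<open>d (v n)\<close>.\<close>
      moreover have "g \<le> d (v (Suc n - k))"
        using v(2)[of "Suc n - k"] that by (intro g(2)) (auto simp: nonzero_image_def)
      ultimately show ?thesis
        using that by (auto simp: c_def)
    qed
    moreover have "c k \<in> ?P" if "k \<in> {1..Suc n}" for k
      using v(2)[of "Suc n - k"] that g(1) by (auto simp: c_def nonzero_image_def)
    moreover have "c 1 = g" "c (Suc n) = d x"
      using False v(1) by (auto simp: c_def)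
    \<comment> \<open>The interval length counts elements and the module length counts inclusions,
      hence \<open>Suc n\<close> against \<open>n\<close>.\<close>
    ultimately have "enat (Suc n) \<le> interval_length ?P g (d x)"
      unfolding interval_length_def
      by (intro Sup_upper CollectI exI[of _ "Suc n"] exI[of _ c] conjI) auto
    then show ?thesis
      by (meson enat_ord_simps(1) le_SucI le_refl order_trans)
  qed
qed

end

section \<open>Values in the natural numbers\<close>

lemma quotient_length_le_nat_value:
  fixes d :: "'b \<Rightarrow> nat"
  assumes "euclidean_module R M d" "submodule N R M" "x \<in> N" "x \<noteq> \<zero>\<^bsub>M\<^esub>"
  shows "module_length R (quotient_module M N) \<le> enat (d x)"
proof (rule euclidean_module.quotient_length_leI[OF assms])
  fix n v
  assume v: "v 0 = x" "\<And>i. i < n \<Longrightarrow> d (v (Suc i)) < d (v i)"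
  \<comment> \<open>Every strict drop in the natural numbers costs at least one.\<close>
  have "i \<le> n \<Longrightarrow> d (v i) + i \<le> d x" for i
  proof (induction i)
    case (Suc i)
    then show ?case
      using v(2)[of i] by simp
  qed (simp add: v(1))
  from this[of n] show "enat n \<le> enat (d x)"
    by simp
qed

section \<open>Least values and the length bounds in terms of them\<close>

lemma least_value_props:
  assumes "has_least_value M d N"
  shows "least_value M d N \<in> nonzero_image M d N"
    and "q \<in> nonzero_image M d N \<Longrightarrow> least_value M d N \<le> q"
proof -
  obtain p where p: "p \<in> nonzero_image M d N" "\<forall>q \<in> nonzero_image M d N. p \<le> q"
    using assms by (auto simp: has_least_value_def)
  then have "least_value M d N = p"
    unfolding least_value_def by (intro Least_equality) auto
  then show "least_value M d N \<in> nonzero_image M d N"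
    and "q \<in> nonzero_image M d N \<Longrightarrow> least_value M d N \<le> q"
    using p by auto
qed

theorem theorem2p7:
  fixes R :: "('a, 'r) ring_scheme" and M :: "('a, 'b, 'm) module_scheme"
    and d :: "'b \<Rightarrow> 'p::order" and dnat :: "'b \<Rightarrow> nat"
  shows "(euclidean_module R M d \<longrightarrow> noetherian_module R M) \<and>
    (euclidean_module R M d \<and> l_finite M d \<and> has_least_value M d (carrier M) \<longrightarrow>
      (\<forall>N. submodule N R M \<and> N \<noteq> {\<zero>\<^bsub>M\<^esub>} \<longrightarrow>
        cofinite_submodule R M N \<and>
        (has_least_value M d N \<longrightarrow>
          module_length R (quotient_module M N)
            \<le> interval_length (nonzero_image M d (carrier M))
                (least_value M d (carrier M)) (least_value M d N)))) \<and>
    (euclidean_module R M dnat \<longrightarrow>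
      (\<forall>N. submodule N R M \<and> N \<noteq> {\<zero>\<^bsub>M\<^esub>} \<longrightarrow>
        module_length R (quotient_module M N) \<le> enat (least_value M dnat N + 1)))"
proof -
  have nonzero: "\<exists>x\<in>N. x \<noteq> \<zero>\<^bsub>M\<^esub>" and carr: "N \<subseteq> carrier M"
    if "submodule N R M" "N \<noteq> {\<zero>\<^bsub>M\<^esub>}" for N
    using that subgroup.one_closed[of N "add_monoid M"] subgroup.subset[of N "add_monoid M"]
    by (auto simp: submodule_def)
  have "euclidean_module R M d \<Longrightarrow> noetherian_module R M"
    by (rule euclidean_module.noetherian)
  moreover have "cofinite_submodule R M N \<and>
        (has_least_value M d N \<longrightarrow>
          module_length R (quotient_module M N)
            \<le> interval_length (nonzero_image M d (carrier M))
                (least_value M d (carrier M)) (least_value M d N))"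
    if E: "euclidean_module R M d" and fin: "l_finite M d"
      and least: "has_least_value M d (carrier M)"
      and N: "submodule N R M" "N \<noteq> {\<zero>\<^bsub>M\<^esub>}" for N
  proof (intro conjI impI)
    note g = least_value_props[OF least]
    have le: "module_length R (quotient_module M N)
        \<le> interval_length (nonzero_image M d (carrier M)) (least_value M d (carrier M)) (d x)"
      if "x \<in> N" "x \<noteq> \<zero>\<^bsub>M\<^esub>" for x
      using euclidean_module.quotient_length_le_interval[OF E N(1) that g] .
    \<comment> \<open>Any nonzero \<open>x\<close> in \<open>N\<close> will do for cofiniteness: the
      interval from the least value on \<open>M\<close> to \<open>d x\<close> has finite
      length.\<close>
    obtain x where x: "x \<in> N" "x \<noteq> \<zero>\<^bsub>M\<^esub>"
      using nonzero[OF N] by blast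
    then have "d x \<in> nonzero_image M d (carrier M)"
      using carr[OF N] by (auto simp: nonzero_image_def)
    then have "interval_length (nonzero_image M d (carrier M)) (least_value M d (carrier M)) (d x)
        < \<infinity>"
      using fin g unfolding l_finite_def by blast
    then show "cofinite_submodule R M N"
      using le[OF x] unfolding cofinite_submodule_def by (rule le_less_trans[rotated])
    assume "has_least_value M d N"
    from least_value_props(1)[OF this]
    obtain y where "y \<in> N" "y \<noteq> \<zero>\<^bsub>M\<^esub>" "least_value M d N = d y"
      by (auto simp: nonzero_image_def)
    then show "module_length R (quotient_module M N)
        \<le> interval_length (nonzero_image M d (carrier M))
            (least_value M d (carrier M)) (least_value M d N)"
      using le[of y] by simp
  qed
  moreover have "module_length R (quotient_module M N) \<le> enat (least_value M dnat N + 1)"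
    if E: "euclidean_module R M dnat" and N: "submodule N R M" "N \<noteq> {\<zero>\<^bsub>M\<^esub>}" for N
  proof -
    obtain y where "dnat y \<in> nonzero_image M dnat N"
      using nonzero[OF N] by (auto simp: nonzero_image_def)
    \<comment> \<open>The natural numbers are well-ordered, so the least value on \<open>N\<close>
      is attained.\<close>
    then have "least_value M dnat N \<in> nonzero_image M dnat N"
      unfolding least_value_def by (rule LeastI)
    then obtain x where x: "x \<in> N" "x \<noteq> \<zero>\<^bsub>M\<^esub>" "least_value M dnat N = dnat x"
      by (auto simp: nonzero_image_def)
    have "module_length R (quotient_module M N) \<le> enat (dnat x)"
      using quotient_length_le_nat_value[OF E N(1) x(1,2)] .
    \<comment> \<open>The argument gives \<open>dnat x\<close> itself, which is weakened to the
      stated bound.\<close>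
    also have "\<dots> \<le> enat (dnat x + 1)"
      by simp
    finally show ?thesis
      by (simp add: x(3))
  qed
  ultimately show ?thesis
    by blast
qed

end
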